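(* Let $X$ be a complex Banach space and let $T\in L(X)$ be such that its Moore-Penrose inverse $T^{\dag}$ exists. Then, for each one of the statements (i)--(viii) below, $T$ is EP if and only if that statement holds: (i) $a(T)<\infty$ and $T(T^{\dag})^2=T^{\dag}$; (ii) $a(T^{\dag})<\infty$ and $T^{\dag}T^2=T$; (iii) $d(T^{\dag})<\infty$ and $T^2T^{\dag}=T$; (iv) $d(T)<\infty$ and $(T^{\dag})^2T=T^{\dag}$; (v) $a(T)<\infty$ and $T^2T^{\dag}=T$; (vi) $a(T^{\dag})<\infty$ and $(T^{\dag})^2T=T^{\dag}$; (vii) $d(T)<\infty$ and $T^{\dag}T^2=T$; (viii) $d(T^{\dag})<\infty$ and $T(T^{\dag})^2=T^{\dag}$. Furthermore, for each one of the identities (ix)--(xii) below, $T$ is EP if and only if the group inverse $T^{\sharp}$ exists and that identity holds: (ix) $T=T^{\dag}T^2$; (x) $T=T^2T^{\dag}$; (xi) $T^{\dag}=T(T^{\dag})^2$; (xii) $T^{\dag}=(T^{\dag})^2T$.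
   Context: $L(X)$ is the unital Banach algebra of all bounded linear operators on the complex Banach space $X$, with the operator norm. $N(S)$ and $R(S)$ denote the null space and range of $S\in L(X)$. The ascent and descent of $S\in L(X)$ are $a(S)=\inf\{n\ge 0: N(S^n)=N(S^{n+1})\}$ and $d(S)=\inf\{n\ge 0: R(S^n)=R(S^{n+1})\}$, where the infimum of the empty set is $\infty$. An operator $H\in L(X)$ is hermitian if $\|\exp(itH)\|=1$ for all $t\in\mathbb{R}$. The Moore-Penrose inverse of $T\in L(X)$, denoted $T^{\dag}$, is the (unique, if it exists) operator $S\in L(X)$ such that $T=TST$, $S=STS$, and both $TS$ and $ST$ are hermitian. The group inverse of $T$, denoted $T^{\sharp}$, is the (unique, if it exists) operator $S\in L(X)$ such that $T=TST$, $S=STS$ and $TS=ST$. The operator $T$ is EP if $T^{\dag}$ exists and $TT^{\dag}=T^{\dag}T$. *)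

theory Defs
  imports "HOL-Analysis.Analysis" "HOL-Library.Extended_Nat"
begin

class complex_vector = real_vector +
  fixes scaleC :: "complex \<Rightarrow> 'a \<Rightarrow> 'a" (infixr \<open>*\<^sub>C\<close> 75)
  assumes scaleC_add_right: "a *\<^sub>C (x + y) = a *\<^sub>C x + a *\<^sub>C y"
    and scaleC_add_left: "(a + b) *\<^sub>C x = a *\<^sub>C x + b *\<^sub>C x"
    and scaleC_scaleC: "a *\<^sub>C (b *\<^sub>C x) = (a * b) *\<^sub>C x"
    and scaleC_of_real: "complex_of_real r *\<^sub>C x = r *\<^sub>R x"

lemma scaleC_one: "1 *\<^sub>C x = (x::'a::complex_vector)"
  using scaleC_of_real [of 1 x] by simp

class complex_normed_vector = complex_vector + real_normed_vector +
  assumes norm_scaleC: "norm (a *\<^sub>C x) = cmod a * norm x"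

class complex_banach = complex_normed_vector + banach

instantiation complex :: complex_banach
begin

definition scaleC_complex :: "complex \<Rightarrow> complex \<Rightarrow> complex"
  where "scaleC_complex a x = a * x"

instance
  by standard
    (simp_all add: scaleC_complex_def algebra_simps norm_mult scaleR_conv_of_real)

end

lemma bounded_linear_scaleC: "bounded_linear (\<lambda>x::'a::complex_normed_vector. a *\<^sub>C x)"
proof (rule bounded_linear_intro)
  fix r :: real and x :: 'a
  show "a *\<^sub>C (r *\<^sub>R x) = r *\<^sub>R (a *\<^sub>C x)"
    by (simp add: scaleC_scaleC mult.commute flip: scaleC_of_real)
  show "norm (a *\<^sub>C x) \<le> norm x * cmod a"
    by (simp add: norm_scaleC mult.commute)
qed (rule scaleC_add_right)

instantiation blinfun :: (real_normed_vector, complex_normed_vector) complex_normed_vector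
begin

lift_definition scaleC_blinfun :: "complex \<Rightarrow> ('a \<Rightarrow>\<^sub>L 'b) \<Rightarrow> ('a \<Rightarrow>\<^sub>L 'b)"
  is "\<lambda>a f x. a *\<^sub>C f x"
  by (rule bounded_linear_compose [OF bounded_linear_scaleC])

instance
proof
  fix a b :: complex and r :: real and f g :: "'a \<Rightarrow>\<^sub>L 'b"
  show "a *\<^sub>C (f + g) = a *\<^sub>C f + a *\<^sub>C g"
    by transfer (simp add: scaleC_add_right)
  show "(a + b) *\<^sub>C f = a *\<^sub>C f + b *\<^sub>C f"
    by transfer (simp add: scaleC_add_left)
  show "a *\<^sub>C (b *\<^sub>C f) = (a * b) *\<^sub>C f"
    by transfer (simp add: scaleC_scaleC)
  show "complex_of_real r *\<^sub>C f = r *\<^sub>R f"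
    by transfer (simp add: scaleC_of_real)
  have le: "norm (c *\<^sub>C h) \<le> cmod c * norm h" for c and h :: "'a \<Rightarrow>\<^sub>L 'b"
  proof (rule norm_blinfun_bound)
    fix x
    have "norm (blinfun_apply (c *\<^sub>C h) x) = cmod c * norm (blinfun_apply h x)"
      by (simp add: scaleC_blinfun.rep_eq norm_scaleC)
    also have "\<dots> \<le> cmod c * (norm h * norm x)"
      by (intro mult_left_mono norm_blinfun norm_ge_zero)
    finally show "norm (blinfun_apply (c *\<^sub>C h) x) \<le> cmod c * norm h * norm x"
      by (simp add: mult.assoc)
  qed simp
  show "norm (a *\<^sub>C f) = cmod a * norm f"
  proof (cases "a = 0")
    case True
    then show ?thesis
      using le [of a f] by simp
  next
    case False
    then have "inverse a *\<^sub>C (a *\<^sub>C f) = f"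
      by transfer (simp add: scaleC_scaleC scaleC_one)
    then have "norm f \<le> inverse (cmod a) * norm (a *\<^sub>C f)"
      using le [of "inverse a" "a *\<^sub>C f"] by (simp add: norm_inverse)
    then have "cmod a * norm f \<le> norm (a *\<^sub>C f)"
      using False by (simp add: field_simps)
    with le [of a f] show ?thesis by simp
  qed
qed

end

instance blinfun :: (real_normed_vector, complex_banach) complex_banach ..

text \<open>
  The library type of bounded operators only requires real linearity. The algebra \<open>L(X)\<close>
  is carved out of it as a closed subalgebra, which has the same operator norm.
\<close>

definition bounded_ops :: "('a::complex_banach \<Rightarrow>\<^sub>L 'a) set"
  where "bounded_ops = {S. \<forall>c x. blinfun_apply S (c *\<^sub>C x) = c *\<^sub>C blinfun_apply S x}"

primrec op_power :: "('a::real_normed_vector \<Rightarrow>\<^sub>L 'a) \<Rightarrow> nat \<Rightarrow> ('a \<Rightarrow>\<^sub>L 'a)"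
    (infixr \<open>^\<^sub>L\<close> 80)
  where
    "S ^\<^sub>L 0 = id_blinfun"
  | "S ^\<^sub>L Suc n = S o\<^sub>L (S ^\<^sub>L n)"

text \<open>
  The library's \<^const>\<open>exp\<close> is not available here: it needs a normed algebra with
  \<open>norm 1 = 1\<close>, which fails on the zero space.
\<close>

definition op_exp :: "('a::banach \<Rightarrow>\<^sub>L 'a) \<Rightarrow> ('a \<Rightarrow>\<^sub>L 'a)"
  where "op_exp S = (\<Sum>n. (S ^\<^sub>L n) /\<^sub>R fact n)"

definition null_space :: "('a::real_normed_vector \<Rightarrow>\<^sub>L 'a) \<Rightarrow> 'a set"
  where "null_space S = {x. blinfun_apply S x = 0}"

definition range_space :: "('a::real_normed_vector \<Rightarrow>\<^sub>L 'a) \<Rightarrow> 'a set"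
  where "range_space S = range (blinfun_apply S)"

text \<open>The infimum of the empty set of extended naturals is \<open>\<infinity>\<close>.\<close>

definition ascent :: "('a::real_normed_vector \<Rightarrow>\<^sub>L 'a) \<Rightarrow> enat"
  where "ascent S = Inf {enat n | n. null_space (S ^\<^sub>L n) = null_space (S ^\<^sub>L (n + 1))}"

definition descent :: "('a::real_normed_vector \<Rightarrow>\<^sub>L 'a) \<Rightarrow> enat"
  where "descent S = Inf {enat n | n. range_space (S ^\<^sub>L n) = range_space (S ^\<^sub>L (n + 1))}"

definition hermitian :: "('a::complex_banach \<Rightarrow>\<^sub>L 'a) \<Rightarrow> bool"
  where "hermitian H \<longleftrightarrow>
    H \<in> bounded_ops \<and> (\<forall>t::real. norm (op_exp ((\<i> * complex_of_real t) *\<^sub>C H)) = 1)"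

definition is_mp_inverse :: "('a::complex_banach \<Rightarrow>\<^sub>L 'a) \<Rightarrow> ('a \<Rightarrow>\<^sub>L 'a) \<Rightarrow> bool"
  where "is_mp_inverse T S \<longleftrightarrow> S \<in> bounded_ops \<and>
    T = T o\<^sub>L S o\<^sub>L T \<and> S = S o\<^sub>L T o\<^sub>L S \<and> hermitian (T o\<^sub>L S) \<and> hermitian (S o\<^sub>L T)"

definition mp_invertible :: "('a::complex_banach \<Rightarrow>\<^sub>L 'a) \<Rightarrow> bool"
  where "mp_invertible T \<longleftrightarrow> (\<exists>S. is_mp_inverse T S)"

definition mp_inverse :: "('a::complex_banach \<Rightarrow>\<^sub>L 'a) \<Rightarrow> ('a \<Rightarrow>\<^sub>L 'a)"
    (\<open>_\<^sup>\<dagger>\<close> [1000] 1000)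
  where "T\<^sup>\<dagger> = (THE S. is_mp_inverse T S)"

definition is_group_inverse :: "('a::complex_banach \<Rightarrow>\<^sub>L 'a) \<Rightarrow> ('a \<Rightarrow>\<^sub>L 'a) \<Rightarrow> bool"
  where "is_group_inverse T S \<longleftrightarrow> S \<in> bounded_ops \<and>
    T = T o\<^sub>L S o\<^sub>L T \<and> S = S o\<^sub>L T o\<^sub>L S \<and> T o\<^sub>L S = S o\<^sub>L T"

definition group_invertible :: "('a::complex_banach \<Rightarrow>\<^sub>L 'a) \<Rightarrow> bool"
  where "group_invertible T \<longleftrightarrow> (\<exists>S. is_group_inverse T S)"

definition EP :: "('a::complex_banach \<Rightarrow>\<^sub>L 'a) \<Rightarrow> bool"
  where "EP T \<longleftrightarrow> mp_invertible T \<and> T o\<^sub>L T\<^sup>\<dagger> = T\<^sup>\<dagger> o\<^sub>L T"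

end

theory Submission
  imports Defs
begin

text \<open>
  Write \<open>S = T\<^sup>\<dagger>\<close>, \<open>P = TS\<close> and \<open>Q = ST\<close>. These are hermitian idempotents with
  \<open>R(P) = R(T)\<close>, \<open>N(P) = N(S)\<close>, \<open>R(Q) = R(S)\<close>, \<open>N(Q) = N(T)\<close>, and \<open>T\<close> is EP iff \<open>P = Q\<close>.

  The analytic input is rigidity: two hermitian idempotents with the same range, or with the same
  null space, are equal. Since \<open>exp(i\<pi>P) = 1 - 2P\<close>, the reflections \<open>1 - 2P\<close> and \<open>1 - 2Q\<close> are
  contractions, and so is their product. When the ranges (or null spaces) agree, that product is
  \<open>1 + D\<close> with \<open>D = \<plusminus>2(P - Q)\<close> and \<open>D\<^sup>2 = 0\<close>. Its powers \<open>1 + nD\<close> are bounded, which forces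
  \<open>D = 0\<close> (\<open>square_zero_perturbation_contraction\<close>). Rigidity also shows that a
  Moore-Penrose inverse is unique, so that \<open>T\<^sup>\<dagger>\<close> can be replaced by any witness, and \<open>(T\<^sup>\<dagger>)\<^sup>\<dagger> = T\<close>.

  Each identity in the theorem says that one of the products \<open>PQ\<close>, \<open>QP\<close> is \<open>P\<close> or \<open>Q\<close>, that is,
  one inclusion between the ranges or the null spaces of \<open>P\<close> and \<open>Q\<close>. The four identities
  \<open>TS\<^sup>2 = S\<close>, \<open>T\<^sup>2S = T\<close>, \<open>S\<^sup>2T = S\<close>, \<open>ST\<^sup>2 = T\<close> represent the four inclusions, and the exchange of
  \<open>T\<close> and \<open>S\<close> permutes them. The first two make \<open>T\<close> equal to some \<open>T\<^sup>2W\<close>, the last two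
  to some \<open>WT\<^sup>2\<close>. If \<open>T = T\<^sup>2W\<close>, then finite ascent makes \<open>T\<close> injective on \<open>R(T)\<close>
  (\<open>cancel_left_if_ascent_finite\<close>). If \<open>T = WT\<^sup>2\<close>, then finite descent makes \<open>T\<close> cancellable from
  the right in products that end with \<open>T\<close> (\<open>cancel_right_if_descent_finite\<close>). Cancelling turns the
  one inclusion into an equality, and rigidity gives \<open>P = Q\<close>.

  These four cases, applied to \<open>(T, S)\<close> and to \<open>(S, T)\<close>, give the conditions on ascent and descent.
  Since the existence of a group inverse bounds ascent and descent by 1, they also give the
  conditions on \<open>T\<^sup>\<sharp>\<close>. Conversely, if \<open>P = Q\<close> then \<open>S\<close> is the group inverse of \<open>T\<close>, ascents and
  descents are at most 1, and all the identities hold.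
\<close>

section \<open>Powers and cancellation under finite ascent or descent\<close>

lemma blinfun_compose_assoc: "(A o\<^sub>L B) o\<^sub>L C = A o\<^sub>L (B o\<^sub>L C)"
  by (rule blinfun_eqI) simp

lemma op_power_apply: "blinfun_apply (S ^\<^sub>L n) = blinfun_apply S ^^ n"
  by (induction n) auto

lemma op_power_2: "S ^\<^sub>L 2 = S o\<^sub>L S"
  by (intro blinfun_eqI) (simp add: numeral_2_eq_2)

lemma Inf_enat_Collect_less_infinity_iff: "Inf {enat n | n. P n} < \<infinity> \<longleftrightarrow> (\<exists>n. P n)"
proof
  assume fin: "Inf {enat n | n. P n} < \<infinity>"
  show "\<exists>n. P n"
  proof (rule ccontr)
    assume "\<not> (\<exists>n. P n)"
    then have "{enat n | n. P n} = {}" by blast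
    with fin show False by (simp add: Inf_enat_def)
  qed
next
  assume "\<exists>n. P n"
  then obtain n where "P n" by blast
  then have "Inf {enat n | n. P n} \<le> enat n" by (intro Inf_lower) blast
  then show "Inf {enat n | n. P n} < \<infinity>"
    by (rule order.strict_trans1) simp
qed

lemma ascent_finite_iff:
  "ascent S < \<infinity> \<longleftrightarrow> (\<exists>n. null_space (S ^\<^sub>L n) = null_space (S ^\<^sub>L Suc n))"
  unfolding ascent_def Inf_enat_Collect_less_infinity_iff by (simp only: Suc_eq_plus1)

lemma descent_finite_iff:
  "descent S < \<infinity> \<longleftrightarrow> (\<exists>n. range_space (S ^\<^sub>L n) = range_space (S ^\<^sub>L Suc n))"
  unfolding descent_def Inf_enat_Collect_less_infinity_iff by (simp only: Suc_eq_plus1)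

text \<open>
  Iterating \<open>T = T\<^sup>2W\<close> gives \<open>T = T\<^sup>n\<^sup>+\<^sup>1W\<^sup>n\<close>. Hence a vector of \<open>R(T)\<close> killed by \<open>T\<close> has the form
  \<open>T\<^sup>n\<^sup>+\<^sup>1v\<close> with \<open>T\<^sup>n\<^sup>+\<^sup>2v = 0\<close>, and when the null spaces stabilise at \<open>n\<close> this vector is \<open>0\<close>.
\<close>

lemma cancel_left_if_ascent_finite:
  assumes "ascent T < \<infinity>" and W: "T = T o\<^sub>L T o\<^sub>L W"
    and eq: "T o\<^sub>L (T o\<^sub>L A) = T o\<^sub>L (T o\<^sub>L B)"
  shows "T o\<^sub>L A = T o\<^sub>L B"
proof (rule blinfun_eqI)
  let ?t = "blinfun_apply T" and ?w = "blinfun_apply W"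
  fix x
  obtain n where n: "null_space (T ^\<^sub>L n) = null_space (T ^\<^sub>L Suc n)"
    using assms(1) unfolding ascent_finite_iff by blast
  have TTW: "T y = T (T (W y))" for y
    using arg_cong[OF W, of "\<lambda>F. blinfun_apply F y"] by simp
  have swap: "(?t ^^ n) (T y) = T ((?t ^^ n) y)" "(?w ^^ n) (W y) = W ((?w ^^ n) y)" for n y
    by (rule funpow_swap1[symmetric])+
  have iter: "T y = (?t ^^ Suc n) ((?w ^^ n) y)" for n y
  proof (induction n arbitrary: y)
    case (Suc n)
    have "T y = T (T (W y))" by (rule TTW)
    also have "\<dots> = T ((?t ^^ Suc n) ((?w ^^ n) (W y)))"
      by (rule arg_cong[OF Suc])
    also have "\<dots> = (?t ^^ Suc (Suc n)) ((?w ^^ Suc n) y)" by (simp add: swap)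
    finally show ?case .
  qed simp
  define z where "z = A x - B x"
  have "T (T z) = 0"
    using eq by (simp add: z_def blinfun.diff_right flip: blinfun_apply_blinfun_compose)
  then have "(?t ^^ Suc n) (T ((?w ^^ n) z)) = 0"
    unfolding iter[of z n] by (simp add: swap)
  then have "T ((?w ^^ n) z) \<in> null_space (T ^\<^sub>L Suc n)"
    by (simp only: null_space_def op_power_apply mem_Collect_eq)
  then have "T ((?w ^^ n) z) \<in> null_space (T ^\<^sub>L n)" by (simp only: n)
  then have "T z = 0"
    unfolding iter[of z n] by (simp add: null_space_def op_power_apply swap)
  then show "(T o\<^sub>L A) x = (T o\<^sub>L B) x"
    by (simp add: z_def blinfun.diff_right)
qed

text \<open>
  Iterating \<open>T = WT\<^sup>2\<close> gives \<open>T = W\<^sup>nT\<^sup>n\<^sup>+\<^sup>1\<close>. When the ranges stabilise at \<open>n\<close>, any \<open>T\<^sup>n\<^sup>+\<^sup>1x\<close> equals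
  some \<open>T\<^sup>n\<^sup>+\<^sup>2y\<close>, so \<open>Tx = W\<^sup>nT\<^sup>n\<^sup>+\<^sup>2y = T\<^sup>2y\<close> and \<open>T\<close> and \<open>T\<^sup>2\<close> have the same range.
\<close>

lemma cancel_right_if_descent_finite:
  assumes "descent T < \<infinity>" and W: "T = W o\<^sub>L T o\<^sub>L T"
    and eq: "A o\<^sub>L T o\<^sub>L T = B o\<^sub>L T o\<^sub>L T"
  shows "A o\<^sub>L T = B o\<^sub>L T"
proof (rule blinfun_eqI)
  let ?t = "blinfun_apply T" and ?w = "blinfun_apply W"
  fix x
  obtain n where n: "range_space (T ^\<^sub>L n) = range_space (T ^\<^sub>L Suc n)"
    using assms(1) unfolding descent_finite_iff by blast
  have WTT: "T y = W (T (T y))" for y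
    using arg_cong[OF W, of "\<lambda>F. blinfun_apply F y"] by simp
  have swap: "(?t ^^ n) (T y) = T ((?t ^^ n) y)" "W ((?w ^^ n) y) = (?w ^^ n) (W y)" for n y
    by (rule funpow_swap1[symmetric], rule funpow_swap1)
  have iter: "T y = (?w ^^ n) ((?t ^^ Suc n) y)" for n y
  proof (induction n arbitrary: y)
    case (Suc n)
    have "(?w ^^ Suc n) ((?t ^^ Suc (Suc n)) y) = (?w ^^ n) (W (T (T ((?t ^^ n) y))))"
      by (simp add: swap)
    also have "\<dots> = T y" using Suc[of y] by (simp flip: WTT)
    finally show ?case by simp
  qed simp
  have "(?t ^^ n) x \<in> range_space (T ^\<^sub>L Suc n)"
    by (subst n[symmetric]) (simp add: range_space_def op_power_apply)
  then obtain y where y: "(?t ^^ n) x = (?t ^^ Suc n) y"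
    unfolding range_space_def op_power_apply by blast
  have "T x = (?w ^^ n) ((?t ^^ Suc n) (T y))"
    unfolding iter[of x n] using y by (simp add: swap)
  then have "T x = T (T y)" by (simp only: iter[of "T y" n])
  then show "(A o\<^sub>L T) x = (B o\<^sub>L T) x"
    using arg_cong[OF eq, of "\<lambda>F. blinfun_apply F y"] by simp
qed

section \<open>Rigidity of hermitian idempotents\<close>

lemma bounded_linear_scaleC_left: "bounded_linear (\<lambda>z::complex. z *\<^sub>C (x::'a::complex_normed_vector))"
proof (rule bounded_linear_intro)
  fix r :: real and z :: complex
  show "(r *\<^sub>R z) *\<^sub>C x = r *\<^sub>R (z *\<^sub>C x)"
    by (simp add: scaleC_scaleC scaleR_conv_of_real flip: scaleC_of_real)
  show "norm (z *\<^sub>C x) \<le> norm z * norm x"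
    by (simp add: norm_scaleC)
qed (rule scaleC_add_left)

lemma op_power_scaleC_idempotent:
  assumes "P \<in> bounded_ops" and "P o\<^sub>L P = P"
  shows "(c *\<^sub>C P) ^\<^sub>L Suc n = c ^ Suc n *\<^sub>C P"
proof (induction n)
  case 0
  show ?case by (simp add: blinfun_eqI)
next
  case (Suc n)
  have "(c *\<^sub>C P) ^\<^sub>L Suc (Suc n) = (c *\<^sub>C P) o\<^sub>L (c ^ Suc n *\<^sub>C P)"
    using Suc by simp
  also have "\<dots> = c ^ Suc (Suc n) *\<^sub>C (P o\<^sub>L P)"
    using assms(1)
    by (intro blinfun_eqI)
      (simp add: scaleC_blinfun.rep_eq bounded_ops_def scaleC_scaleC)
  finally show ?case using assms(2) by simp
qed

text \<open>
  All powers \<open>P\<^sup>n\<close> with \<open>n \<ge> 1\<close> are \<open>P\<close>, so the exponential series is the scalar one times \<open>P\<close>, except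
  for its constant term, which is \<open>1\<close> instead of \<open>P\<close>.
\<close>

lemma op_exp_scaleC_idempotent:
  fixes P :: "'a::complex_banach \<Rightarrow>\<^sub>L 'a"
  assumes "P \<in> bounded_ops" and "P o\<^sub>L P = P"
  shows "op_exp (c *\<^sub>C P) = (id_blinfun - P) + exp c *\<^sub>C P"
proof -
  have "(\<lambda>n. c ^ n /\<^sub>R fact n) sums exp c"
    by (rule exp_converges)
  then have "(\<lambda>n. (c ^ n /\<^sub>R fact n) *\<^sub>C P) sums (exp c *\<^sub>C P)"
    by (rule bounded_linear.sums[OF bounded_linear_scaleC_left])
  moreover have "(\<lambda>n. if n = 0 then id_blinfun - P else 0) sums (id_blinfun - P)"
    using sums_single[of 0 "\<lambda>_. id_blinfun - P"] by simp
  ultimately have "(\<lambda>n. (if n = 0 then id_blinfun - P else 0) + (c ^ n /\<^sub>R fact n) *\<^sub>C P)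
      sums ((id_blinfun - P) + exp c *\<^sub>C P)"
    by (intro sums_add)
  moreover have "(if n = 0 then id_blinfun - P else 0) + (c ^ n /\<^sub>R fact n) *\<^sub>C P
      = ((c *\<^sub>C P) ^\<^sub>L n) /\<^sub>R fact n" for n
  proof (cases n)
    case 0
    then show ?thesis by (simp add: scaleC_one)
  next
    case (Suc m)
    then show ?thesis
      using op_power_scaleC_idempotent[OF assms, of c m]
      by (simp only: linear_scale[OF bounded_linear.linear[OF bounded_linear_scaleC_left]]) simp
  qed
  ultimately show ?thesis
    unfolding op_exp_def by (simp add: sums_iff)
qed

lemma norm_reflection_hermitian_idempotent:
  assumes "hermitian P" and "P o\<^sub>L P = P"
  shows "norm (id_blinfun - 2 *\<^sub>R P) = 1"
proof -
  have P: "P \<in> bounded_ops" using assms(1) by (simp add: hermitian_def)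
  have "op_exp ((\<i> * complex_of_real pi) *\<^sub>C P) = (id_blinfun - P) + (- 1) *\<^sub>C P"
    using op_exp_scaleC_idempotent[OF P assms(2), of "\<i> * complex_of_real pi"]
    by (simp add: exp_pi_i)
  also have "(- 1) *\<^sub>C P = - P"
    using scaleC_of_real[of "- 1" P] by simp
  also have "(id_blinfun - P) + - P = id_blinfun - 2 *\<^sub>R P"
    by (simp add: scaleR_2)
  finally show ?thesis
    using assms(1) unfolding hermitian_def by metis
qed

text \<open>The powers \<open>(1 + D)\<^sup>n = 1 + nD\<close> are bounded only if \<open>D = 0\<close>.\<close>

lemma square_zero_perturbation_contraction:
  fixes D :: "'a::real_normed_vector \<Rightarrow>\<^sub>L 'a"
  assumes sq: "D o\<^sub>L D = 0" and le: "norm (id_blinfun + D) \<le> 1"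
  shows "D = 0"
proof (rule ccontr)
  assume "D \<noteq> 0"
  have sq': "D (D x) = 0" for x
    using arg_cong[OF sq, of "\<lambda>F. blinfun_apply F x"] by simp
  have pow: "(id_blinfun + D) ^\<^sub>L n = id_blinfun + real n *\<^sub>R D" for n
  proof (induction n)
    case (Suc n)
    then show ?case
      by (intro blinfun_eqI) (simp add: blinfun.bilinear_simps sq' algebra_simps)
  qed simp
  have pow_le: "norm ((id_blinfun + D) ^\<^sub>L n) \<le> 1" for n
  proof (induction n)
    case 0
    show ?case by (simp add: norm_blinfun_id_le)
  next
    case (Suc n)
    have "norm ((id_blinfun + D) ^\<^sub>L Suc n)
        \<le> norm (id_blinfun + D) * norm ((id_blinfun + D) ^\<^sub>L n)"
      by (simp add: norm_blinfun_compose)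
    also have "\<dots> \<le> 1 * 1"
      using le Suc by (intro mult_mono) auto
    finally show ?case by simp
  qed
  have bound: "real n * norm D \<le> 2" for n
  proof -
    have "real n * norm D = norm ((id_blinfun + D) ^\<^sub>L n - id_blinfun)"
      by (simp add: pow)
    also have "\<dots> \<le> norm ((id_blinfun + D) ^\<^sub>L n) + norm (id_blinfun :: 'a \<Rightarrow>\<^sub>L 'a)"
      by (rule norm_triangle_ineq4)
    also have "\<dots> \<le> 2"
      using pow_le[of n] norm_blinfun_id_le[where 'a = 'a] by linarith
    finally show ?thesis .
  qed
  obtain n where "2 < real n * norm D"
    using \<open>D \<noteq> 0\<close> by (metis reals_Archimedean3 zero_less_norm_iff)
  with bound[of n] show False by simp
qed

lemma norm_product_reflections_le:
  assumes "hermitian P" "P o\<^sub>L P = P" "hermitian Q" "Q o\<^sub>L Q = Q"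
  shows "norm ((id_blinfun - 2 *\<^sub>R P) o\<^sub>L (id_blinfun - 2 *\<^sub>R Q)) \<le> 1"
  using norm_blinfun_compose[of "id_blinfun - 2 *\<^sub>R P" "id_blinfun - 2 *\<^sub>R Q"]
  by (simp add: norm_reflection_hermitian_idempotent assms)

text \<open>
  The hypotheses \<open>PQ = Q\<close> and \<open>QP = P\<close> say that \<open>P\<close> and \<open>Q\<close> have the same range. They
  give \<open>(1 - 2P)(1 - 2Q) = 1 - 2(P - Q)\<close> and \<open>(P - Q)\<^sup>2 = 0\<close>.
\<close>

lemma hermitian_idempotents_eq_if_same_range:
  assumes "hermitian P" "P o\<^sub>L P = P" "hermitian Q" "Q o\<^sub>L Q = Q"
    and "P o\<^sub>L Q = Q" and "Q o\<^sub>L P = P"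
  shows "P = Q"
proof -
  define D where "D = 2 *\<^sub>R (Q - P)"
  have app: "P (P x) = P x" "Q (Q x) = Q x" "P (Q x) = Q x" "Q (P x) = P x" for x
    using assms(2,4-6) by (metis blinfun_apply_blinfun_compose)+
  have "(id_blinfun - 2 *\<^sub>R P) o\<^sub>L (id_blinfun - 2 *\<^sub>R Q) = id_blinfun + D"
    by (intro blinfun_eqI) (simp add: D_def blinfun.bilinear_simps app algebra_simps flip: scaleR_2)
  then have "norm (id_blinfun + D) \<le> 1"
    using norm_product_reflections_le[OF assms(1-4)] by simp
  moreover have "D o\<^sub>L D = 0"
    by (intro blinfun_eqI) (simp add: D_def blinfun.bilinear_simps app algebra_simps)
  ultimately have "D = 0" by (rule square_zero_perturbation_contraction[rotated])
  then show ?thesis by (simp add: D_def)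
qed

text \<open>
  The hypotheses \<open>PQ = P\<close> and \<open>QP = Q\<close> say that \<open>P\<close> and \<open>Q\<close> have the same null space. The
  product of the reflections is now \<open>1 + 2(P - Q)\<close>.
\<close>

lemma hermitian_idempotents_eq_if_same_null_space:
  assumes "hermitian P" "P o\<^sub>L P = P" "hermitian Q" "Q o\<^sub>L Q = Q"
    and "P o\<^sub>L Q = P" and "Q o\<^sub>L P = Q"
  shows "P = Q"
proof -
  define D where "D = 2 *\<^sub>R (P - Q)"
  have app: "P (P x) = P x" "Q (Q x) = Q x" "P (Q x) = P x" "Q (P x) = Q x" for x
    using assms(2,4-6) by (metis blinfun_apply_blinfun_compose)+
  have "(id_blinfun - 2 *\<^sub>R P) o\<^sub>L (id_blinfun - 2 *\<^sub>R Q) = id_blinfun + D"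
    by (intro blinfun_eqI) (simp add: D_def blinfun.bilinear_simps app algebra_simps flip: scaleR_2)
  then have "norm (id_blinfun + D) \<le> 1"
    using norm_product_reflections_le[OF assms(1-4)] by simp
  moreover have "D o\<^sub>L D = 0"
    by (intro blinfun_eqI) (simp add: D_def blinfun.bilinear_simps app algebra_simps)
  ultimately have "D = 0" by (rule square_zero_perturbation_contraction[rotated])
  then show ?thesis by (simp add: D_def)
qed

section \<open>Moore-Penrose inverses\<close>

lemma is_mp_inverse_commute:
  assumes "T \<in> bounded_ops" "is_mp_inverse T S"
  shows "is_mp_inverse S T"
  using assms by (auto simp: is_mp_inverse_def)

lemma is_mp_inverseD:
  assumes "is_mp_inverse T S"
  shows "T o\<^sub>L (S o\<^sub>L T) = T" "S o\<^sub>L (T o\<^sub>L S) = S"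
    and "T o\<^sub>L (S o\<^sub>L (T o\<^sub>L A)) = T o\<^sub>L A" "S o\<^sub>L (T o\<^sub>L (S o\<^sub>L A)) = S o\<^sub>L A"
    and "hermitian (T o\<^sub>L S)" "hermitian (S o\<^sub>L T)"
  using assms unfolding is_mp_inverse_def by (metis blinfun_compose_assoc)+

text \<open>
  For two inverses \<open>S\<close>, \<open>S'\<close> of \<open>T\<close>, both \<open>TS\<close> and \<open>TS'\<close> have range \<open>R(T)\<close>, and both \<open>ST\<close>
  and \<open>S'T\<close> have null space \<open>N(T)\<close>. Rigidity gives \<open>S = STS = S'TS = S'TS' = S'\<close>.
\<close>

lemma is_mp_inverse_unique:
  assumes "is_mp_inverse T S" "is_mp_inverse T S'"
  shows "S = S'"
proof -
  note rules = is_mp_inverseD[OF assms(1)] is_mp_inverseD[OF assms(2)]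
  have "T o\<^sub>L S = T o\<^sub>L S'"
    by (rule hermitian_idempotents_eq_if_same_range)
      (simp_all add: rules blinfun_compose_assoc)
  moreover have "S o\<^sub>L T = S' o\<^sub>L T"
    by (rule hermitian_idempotents_eq_if_same_null_space)
      (simp_all add: rules blinfun_compose_assoc)
  ultimately show ?thesis
    by (metis rules(2) rules(8) blinfun_compose_assoc)
qed

lemma mp_inverse_eqI: "is_mp_inverse T S \<Longrightarrow> T\<^sup>\<dagger> = S"
  unfolding mp_inverse_def by (rule the_equality) (auto intro: is_mp_inverse_unique)

text \<open>
  By uniqueness \<open>T\<^sup>\<dagger>\<close> can be replaced by a given witness, so that all later arguments are about a pair
  \<open>(T, S)\<close> in which the roles of \<open>T\<close> and \<open>S\<close> can be exchanged.
\<close>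

lemma EP_iff_commute: "is_mp_inverse T S \<Longrightarrow> EP T \<longleftrightarrow> T o\<^sub>L S = S o\<^sub>L T"
  by (auto simp: EP_def mp_invertible_def mp_inverse_eqI)

lemma group_inverse_of_commuting_mp_inverse:
  assumes "is_mp_inverse T S" "T o\<^sub>L S = S o\<^sub>L T"
  shows "is_group_inverse T S"
  using assms by (auto simp: is_group_inverse_def is_mp_inverse_def)

text \<open>A group inverse \<open>G\<close> gives \<open>T = GT\<^sup>2 = T\<^sup>2G\<close>, so null spaces and ranges stabilise at 1.\<close>

lemma group_invertible_ascent_descent_finite:
  assumes "group_invertible T"
  shows "ascent T < \<infinity>" "descent T < \<infinity>"
proof -
  obtain G where "is_group_inverse T G" using assms by (auto simp: group_invertible_def)
  then have "G o\<^sub>L (T o\<^sub>L T) = T" "T o\<^sub>L (T o\<^sub>L G) = T"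
    unfolding is_group_inverse_def by (metis blinfun_compose_assoc)+
  then have G: "G (T (T x)) = T x" "T (T (G x)) = T x" for x
    by (metis blinfun_apply_blinfun_compose)+
  have "null_space (T ^\<^sub>L 1) = null_space (T ^\<^sub>L Suc 1)"
  proof -
    have "T x = 0 \<longleftrightarrow> T (T x) = 0" for x
      using G(1)[of x] by (auto simp: blinfun.zero_right)
    then show ?thesis by (simp add: null_space_def)
  qed
  then show "ascent T < \<infinity>" unfolding ascent_finite_iff by blast
  have "range_space (T ^\<^sub>L 1) = range_space (T ^\<^sub>L Suc 1)"
    unfolding range_space_def using G(2) by (auto simp: image_iff) metis
  then show "descent T < \<infinity>" unfolding descent_finite_iff by blast
qed

section \<open>One identity and finite ascent or descent imply EP\<close>

text \<open>
  In each of the four lemmas the identity supplies one of the two relations required by rigidity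
  for \<open>TS\<close> and \<open>ST\<close>; cancelling \<open>T\<close> supplies the other.
\<close>

text \<open>Here \<open>R(ST) \<subseteq> R(TS)\<close> and \<open>T = T\<^sup>2(S\<^sup>2T)\<close>.\<close>

lemma commute_if_ascent_and_TSS:
  assumes mp: "is_mp_inverse T S" and "ascent T < \<infinity>" and S: "T o\<^sub>L (S o\<^sub>L S) = S"
  shows "T o\<^sub>L S = S o\<^sub>L T"
proof -
  note rules = is_mp_inverseD[OF mp]
  have S': "T o\<^sub>L (S o\<^sub>L (S o\<^sub>L A)) = S o\<^sub>L A" for A
    using S by (metis blinfun_compose_assoc)
  \<comment> \<open>Because \<open>R(S) \<subseteq> R(T)\<close>, the product \<open>(ST)(TS)\<close> can be written with \<open>T\<close> in front.\<close>
  have "T o\<^sub>L S = T o\<^sub>L (S o\<^sub>L (S o\<^sub>L (T o\<^sub>L (T o\<^sub>L S))))"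
  proof (rule cancel_left_if_ascent_finite[OF assms(2)])
    show "T = T o\<^sub>L T o\<^sub>L (S o\<^sub>L S o\<^sub>L T)"
      by (simp add: blinfun_compose_assoc S' rules)
    show "T o\<^sub>L (T o\<^sub>L S) = T o\<^sub>L (T o\<^sub>L (S o\<^sub>L (S o\<^sub>L (T o\<^sub>L (T o\<^sub>L S)))))"
      by (simp add: S' rules)
  qed
  then have "S o\<^sub>L (T o\<^sub>L (T o\<^sub>L S)) = T o\<^sub>L S" unfolding S' by (rule sym)
  then show ?thesis
    by - (rule hermitian_idempotents_eq_if_same_range,
      simp_all add: rules blinfun_compose_assoc S')
qed

text \<open>Here \<open>N(TS) \<subseteq> N(ST)\<close> and \<open>T = T\<^sup>2S\<close>.\<close>

lemma commute_if_ascent_and_TTS: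
  assumes mp: "is_mp_inverse T S" and "ascent T < \<infinity>" and T: "T o\<^sub>L (T o\<^sub>L S) = T"
  shows "T o\<^sub>L S = S o\<^sub>L T"
proof -
  note rules = is_mp_inverseD[OF mp]
  have T': "T o\<^sub>L (T o\<^sub>L (S o\<^sub>L A)) = T o\<^sub>L A" for A
    using T by (metis blinfun_compose_assoc)
  have "T o\<^sub>L S = T o\<^sub>L (S o\<^sub>L (S o\<^sub>L T))"
  proof (rule cancel_left_if_ascent_finite[OF assms(2)])
    show "T = T o\<^sub>L T o\<^sub>L S"
      by (simp add: blinfun_compose_assoc T)
    show "T o\<^sub>L (T o\<^sub>L S) = T o\<^sub>L (T o\<^sub>L (S o\<^sub>L (S o\<^sub>L T)))"
      by (simp add: T T' rules)
  qed
  then have "T o\<^sub>L (S o\<^sub>L (S o\<^sub>L T)) = T o\<^sub>L S" by (rule sym)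
  then show ?thesis
    by - (rule hermitian_idempotents_eq_if_same_null_space,
      simp_all add: rules blinfun_compose_assoc T)
qed

text \<open>Here \<open>N(ST) \<subseteq> N(TS)\<close> and \<open>T = (TS\<^sup>2)T\<^sup>2\<close>.\<close>

lemma commute_if_descent_and_SST:
  assumes mp: "is_mp_inverse T S" and "descent T < \<infinity>" and S: "S o\<^sub>L (S o\<^sub>L T) = S"
  shows "T o\<^sub>L S = S o\<^sub>L T"
proof -
  note rules = is_mp_inverseD[OF mp]
  have S': "S o\<^sub>L (S o\<^sub>L (T o\<^sub>L A)) = S o\<^sub>L A" for A
    using S by (metis blinfun_compose_assoc)
  \<comment> \<open>Because \<open>S = S\<^sup>2T\<close>, the product \<open>(ST)(TS)\<close> can be written with \<open>T\<close> at the end.\<close>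
  have "S o\<^sub>L T = (S o\<^sub>L T o\<^sub>L T o\<^sub>L S o\<^sub>L S) o\<^sub>L T"
  proof (rule cancel_right_if_descent_finite[OF assms(2)])
    show "T = (T o\<^sub>L S o\<^sub>L S) o\<^sub>L T o\<^sub>L T"
      by (simp add: blinfun_compose_assoc S' rules)
    show "S o\<^sub>L T o\<^sub>L T = (S o\<^sub>L T o\<^sub>L T o\<^sub>L S o\<^sub>L S) o\<^sub>L T o\<^sub>L T"
      by (simp add: blinfun_compose_assoc S' rules)
  qed
  then have "S o\<^sub>L (T o\<^sub>L (T o\<^sub>L S)) = S o\<^sub>L T"
    unfolding blinfun_compose_assoc S by (rule sym)
  then show ?thesis
    by - (rule hermitian_idempotents_eq_if_same_null_space,
      simp_all add: rules blinfun_compose_assoc S)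
qed

text \<open>Here \<open>R(TS) \<subseteq> R(ST)\<close> and \<open>T = ST\<^sup>2\<close>.\<close>

lemma commute_if_descent_and_STT:
  assumes mp: "is_mp_inverse T S" and "descent T < \<infinity>" and T: "S o\<^sub>L (T o\<^sub>L T) = T"
  shows "T o\<^sub>L S = S o\<^sub>L T"
proof -
  note rules = is_mp_inverseD[OF mp]
  have T': "S o\<^sub>L (T o\<^sub>L (T o\<^sub>L A)) = T o\<^sub>L A" for A
    using T by (metis blinfun_compose_assoc)
  have "S o\<^sub>L T = (T o\<^sub>L S o\<^sub>L S) o\<^sub>L T"
  proof (rule cancel_right_if_descent_finite[OF assms(2)])
    show "T = S o\<^sub>L T o\<^sub>L T"
      by (simp add: blinfun_compose_assoc T)
    show "S o\<^sub>L T o\<^sub>L T = (T o\<^sub>L S o\<^sub>L S) o\<^sub>L T o\<^sub>L T"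
      by (simp add: blinfun_compose_assoc T rules)
  qed
  then have "T o\<^sub>L (S o\<^sub>L (S o\<^sub>L T)) = S o\<^sub>L T"
    unfolding blinfun_compose_assoc by (rule sym)
  then show ?thesis
    by - (rule hermitian_idempotents_eq_if_same_range,
      simp_all add: rules blinfun_compose_assoc T')
qed

section \<open>The characterizations of EP operators\<close>

lemma commute_identities:
  assumes "is_mp_inverse T S" and "T o\<^sub>L S = S o\<^sub>L T"
  shows "T o\<^sub>L (S o\<^sub>L S) = S" "S o\<^sub>L (T o\<^sub>L T) = T" "T o\<^sub>L (T o\<^sub>L S) = T" "S o\<^sub>L (S o\<^sub>L T) = S"
  using is_mp_inverseD(1,2)[OF assms(1)] assms(2) by (metis blinfun_compose_assoc)+

lemma commute_iff_ascent_descent: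
  assumes "is_mp_inverse T S"
  shows "T o\<^sub>L S = S o\<^sub>L T \<longleftrightarrow> ascent T < \<infinity> \<and> T o\<^sub>L (S o\<^sub>L S) = S"
    and "T o\<^sub>L S = S o\<^sub>L T \<longleftrightarrow> ascent T < \<infinity> \<and> T o\<^sub>L (T o\<^sub>L S) = T"
    and "T o\<^sub>L S = S o\<^sub>L T \<longleftrightarrow> descent T < \<infinity> \<and> S o\<^sub>L (S o\<^sub>L T) = S"
    and "T o\<^sub>L S = S o\<^sub>L T \<longleftrightarrow> descent T < \<infinity> \<and> S o\<^sub>L (T o\<^sub>L T) = T"
proof -
  have fin: "ascent T < \<infinity>" "descent T < \<infinity>" if "T o\<^sub>L S = S o\<^sub>L T"
    using group_inverse_of_commuting_mp_inverse[OF assms that]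
      group_invertible_ascent_descent_finite[of T]
    unfolding group_invertible_def by blast+
  note ids = commute_identities[OF assms]
  show "T o\<^sub>L S = S o\<^sub>L T \<longleftrightarrow> ascent T < \<infinity> \<and> T o\<^sub>L (S o\<^sub>L S) = S"
    using fin(1) ids(1) commute_if_ascent_and_TSS[OF assms] by blast
  show "T o\<^sub>L S = S o\<^sub>L T \<longleftrightarrow> ascent T < \<infinity> \<and> T o\<^sub>L (T o\<^sub>L S) = T"
    using fin(1) ids(3) commute_if_ascent_and_TTS[OF assms] by blast
  show "T o\<^sub>L S = S o\<^sub>L T \<longleftrightarrow> descent T < \<infinity> \<and> S o\<^sub>L (S o\<^sub>L T) = S"
    using fin(2) ids(4) commute_if_descent_and_SST[OF assms] by blast
  show "T o\<^sub>L S = S o\<^sub>L T \<longleftrightarrow> descent T < \<infinity> \<and> S o\<^sub>L (T o\<^sub>L T) = T"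
    using fin(2) ids(2) commute_if_descent_and_STT[OF assms] by blast
qed

text \<open>
  A group inverse bounds both ascent and descent, so each identity can be paired with whichever of
  the two its own case requires.
\<close>

lemma commute_iff_group_invertible:
  assumes "is_mp_inverse T S"
  shows "T o\<^sub>L S = S o\<^sub>L T \<longleftrightarrow> group_invertible T \<and> T = S o\<^sub>L (T o\<^sub>L T)"
    and "T o\<^sub>L S = S o\<^sub>L T \<longleftrightarrow> group_invertible T \<and> T = T o\<^sub>L (T o\<^sub>L S)"
    and "T o\<^sub>L S = S o\<^sub>L T \<longleftrightarrow> group_invertible T \<and> S = T o\<^sub>L (S o\<^sub>L S)"
    and "T o\<^sub>L S = S o\<^sub>L T \<longleftrightarrow> group_invertible T \<and> S = S o\<^sub>L (S o\<^sub>L T)"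
proof -
  have ginv: "group_invertible T" if "T o\<^sub>L S = S o\<^sub>L T"
    using group_inverse_of_commuting_mp_inverse[OF assms that]
    unfolding group_invertible_def by blast
  note fin = group_invertible_ascent_descent_finite[of T]
  note ids = commute_identities[OF assms]
  note iffs = commute_iff_ascent_descent[OF assms]
  show "T o\<^sub>L S = S o\<^sub>L T \<longleftrightarrow> group_invertible T \<and> T = S o\<^sub>L (T o\<^sub>L T)"
    using ginv fin(2) ids(2) iffs(4) by metis
  show "T o\<^sub>L S = S o\<^sub>L T \<longleftrightarrow> group_invertible T \<and> T = T o\<^sub>L (T o\<^sub>L S)"
    using ginv fin(1) ids(3) iffs(2) by metis
  show "T o\<^sub>L S = S o\<^sub>L T \<longleftrightarrow> group_invertible T \<and> S = T o\<^sub>L (S o\<^sub>L S)"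
    using ginv fin(1) ids(1) iffs(1) by metis
  show "T o\<^sub>L S = S o\<^sub>L T \<longleftrightarrow> group_invertible T \<and> S = S o\<^sub>L (S o\<^sub>L T)"
    using ginv fin(2) ids(4) iffs(3) by metis
qed

theorem theorem2p4:
  fixes T :: "'a::complex_banach \<Rightarrow>\<^sub>L 'a"
  assumes "T \<in> bounded_ops"
    and "mp_invertible T"
  shows "(EP T \<longleftrightarrow> ascent T < \<infinity> \<and> T o\<^sub>L (T\<^sup>\<dagger> ^\<^sub>L 2) = T\<^sup>\<dagger>)
    \<and> (EP T \<longleftrightarrow> ascent (T\<^sup>\<dagger>) < \<infinity> \<and> T\<^sup>\<dagger> o\<^sub>L (T ^\<^sub>L 2) = T)
    \<and> (EP T \<longleftrightarrow> descent (T\<^sup>\<dagger>) < \<infinity> \<and> (T ^\<^sub>L 2) o\<^sub>L T\<^sup>\<dagger> = T)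
    \<and> (EP T \<longleftrightarrow> descent T < \<infinity> \<and> (T\<^sup>\<dagger> ^\<^sub>L 2) o\<^sub>L T = T\<^sup>\<dagger>)
    \<and> (EP T \<longleftrightarrow> ascent T < \<infinity> \<and> (T ^\<^sub>L 2) o\<^sub>L T\<^sup>\<dagger> = T)
    \<and> (EP T \<longleftrightarrow> ascent (T\<^sup>\<dagger>) < \<infinity> \<and> (T\<^sup>\<dagger> ^\<^sub>L 2) o\<^sub>L T = T\<^sup>\<dagger>)
    \<and> (EP T \<longleftrightarrow> descent T < \<infinity> \<and> T\<^sup>\<dagger> o\<^sub>L (T ^\<^sub>L 2) = T)
    \<and> (EP T \<longleftrightarrow> descent (T\<^sup>\<dagger>) < \<infinity> \<and> T o\<^sub>L (T\<^sup>\<dagger> ^\<^sub>L 2) = T\<^sup>\<dagger>)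
    \<and> (EP T \<longleftrightarrow> group_invertible T \<and> T = T\<^sup>\<dagger> o\<^sub>L (T ^\<^sub>L 2))
    \<and> (EP T \<longleftrightarrow> group_invertible T \<and> T = (T ^\<^sub>L 2) o\<^sub>L T\<^sup>\<dagger>)
    \<and> (EP T \<longleftrightarrow> group_invertible T \<and> T\<^sup>\<dagger> = T o\<^sub>L (T\<^sup>\<dagger> ^\<^sub>L 2))
    \<and> (EP T \<longleftrightarrow> group_invertible T \<and> T\<^sup>\<dagger> = (T\<^sup>\<dagger> ^\<^sub>L 2) o\<^sub>L T)"
proof -
  obtain S where mp: "is_mp_inverse T S" using assms(2) by (auto simp: mp_invertible_def)
  have dagger: "T\<^sup>\<dagger> = S" using mp by (rule mp_inverse_eqI)
  have EP: "EP T \<longleftrightarrow> T o\<^sub>L S = S o\<^sub>L T" using mp by (rule EP_iff_commute)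
  have EP': "EP T \<longleftrightarrow> S o\<^sub>L T = T o\<^sub>L S" using EP by auto
  note T_iffs = commute_iff_ascent_descent[OF mp, folded EP]
  note S_iffs = commute_iff_ascent_descent[OF is_mp_inverse_commute[OF assms(1) mp], folded EP']
  show ?thesis
    unfolding dagger op_power_2 blinfun_compose_assoc
    by (intro conjI T_iffs S_iffs commute_iff_group_invertible[OF mp, folded EP])
qed

end
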